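(* Let $k\ge2$ and $m$ be integers with $m=\binom{k-1}{2}+a(k-1)+b$ for some integers $a>0$ and $0\le b\le k-2$. Among all threshold graphs $G$ with clique number $k$ and exactly $m$ edges, $h(G)$ is maximized by the graph $\mathcal{C}(m,k)$.
   Context: $h(G)=\sum_i f(d_i)$ where $(d_i)$ is the degree sequence of $G$ and $f(x)=x\log x$ (with $f(0)=0$). A threshold graph is a graph whose vertex set can be partitioned into a clique and a stable set such that the neighborhoods of the vertices of the stable set are nested (totally ordered by inclusion). The graph $\mathcal{C}(m,k)$, for $m=\binom{k-1}{2}+a(k-1)+b$ with $a\ge0$, $0\le b\le k-2$, consists of a clique $K_{k-1}$, a stable set of $a$ further vertices each adjacent to all vertices of the clique, and one additional vertex adjacent to exactly $b$ vertices of the clique $K_{k-1}$. *)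

theory Defs
  imports Complex_Main
begin

type_synonym 'a ugraph = "'a set \<times> 'a set set"

abbreviation uverts :: "'a ugraph \<Rightarrow> 'a set" where "uverts G \<equiv> fst G"
abbreviation uedges :: "'a ugraph \<Rightarrow> 'a set set" where "uedges G \<equiv> snd G"

definition simple_graph :: "'a ugraph \<Rightarrow> bool" where
  "simple_graph G \<longleftrightarrow> finite (uverts G) \<and> (\<forall>e\<in>uedges G. e \<subseteq> uverts G \<and> card e = 2)"

definition nbhd :: "'a ugraph \<Rightarrow> 'a \<Rightarrow> 'a set" where
  "nbhd G v = {u \<in> uverts G. {u, v} \<in> uedges G}"

definition degree :: "'a ugraph \<Rightarrow> 'a \<Rightarrow> nat" where
  "degree G v = card (nbhd G v)"

definition is_clique :: "'a ugraph \<Rightarrow> 'a set \<Rightarrow> bool" where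
  "is_clique G K \<longleftrightarrow> K \<subseteq> uverts G \<and> (\<forall>u\<in>K. \<forall>v\<in>K. u \<noteq> v \<longrightarrow> {u, v} \<in> uedges G)"

definition is_stable :: "'a ugraph \<Rightarrow> 'a set \<Rightarrow> bool" where
  "is_stable G S \<longleftrightarrow> S \<subseteq> uverts G \<and> (\<forall>u\<in>S. \<forall>v\<in>S. {u, v} \<notin> uedges G)"

definition clique_number :: "'a ugraph \<Rightarrow> nat" where
  "clique_number G = Max (card ` {K. is_clique G K})"

definition threshold_graph :: "'a ugraph \<Rightarrow> bool" where
  "threshold_graph G \<longleftrightarrow> simple_graph G \<and>
     (\<exists>K S. K \<union> S = uverts G \<and> K \<inter> S = {} \<and> is_clique G K \<and> is_stable G S \<and>
        (\<forall>u\<in>S. \<forall>v\<in>S. nbhd G u \<subseteq> nbhd G v \<or> nbhd G v \<subseteq> nbhd G u))"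

text \<open>The convention \<open>f 0 = 0\<close> holds automatically because of the factor \<open>x\<close>.\<close>
definition xlogx :: "real \<Rightarrow> real" where
  "xlogx x = x * ln x"

definition h :: "'a ugraph \<Rightarrow> real" where
  "h G = (\<Sum>v\<in>uverts G. xlogx (real (degree G v)))"

text \<open>
  The clique is on \<open>0, \<dots>, k - 2\<close>; the vertices \<open>k - 1, \<dots>, k - 2 + a\<close> are stable and joined to
  the whole clique; the additional vertex \<open>k - 1 + a\<close> is joined to \<open>0, \<dots>, b - 1\<close>
  (and is isolated if \<open>b = 0\<close>).
\<close>
definition C_graph_ab :: "nat \<Rightarrow> nat \<Rightarrow> nat \<Rightarrow> nat ugraph" where
  "C_graph_ab k a b =
     ({..<k - 1} \<union> {k - 1..<k - 1 + a} \<union> {k - 1 + a},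
      {{u, v} |u v. u < k - 1 \<and> v < k - 1 \<and> u \<noteq> v}
      \<union> {{u, v} |u v. u < k - 1 \<and> v \<in> {k - 1..<k - 1 + a}}
      \<union> {{u, k - 1 + a} |u. u < b})"

text \<open>
  For \<open>k \<ge> 2\<close> the pair \<open>(a, b)\<close> with \<open>m = (k - 1 choose 2) + a * (k - 1) + b\<close> and
  \<open>b \<le> k - 2\<close> is unique, being quotient and remainder of a division by \<open>k - 1\<close>.
\<close>
definition C_graph :: "nat \<Rightarrow> nat \<Rightarrow> nat ugraph" where
  "C_graph m k =
     C_graph_ab k ((m - (k - 1 choose 2)) div (k - 1)) ((m - (k - 1 choose 2)) mod (k - 1))"

lemma C_graph_eq:
  assumes "k \<ge> 2" and "b \<le> k - 2" and "m = (k - 1 choose 2) + a * (k - 1) + b"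
  shows "C_graph m k = C_graph_ab k a b"
proof -
  have "b < k - 1" using assms by linarith
  moreover have "m - (k - 1 choose 2) = b + a * (k - 1)" using assms by simp
  ultimately show ?thesis unfolding C_graph_def by simp
qed

end

theory Submission
  imports Defs
begin

text \<open>
  Write \<open>f x = x ln x\<close> and \<open>n = k - 1\<close>. The vertex set splits into a clique of size \<open>n\<close> and a stable
  set containing a vertex joined to the whole clique. The bipartite part is then a Ferrers diagram of
  width \<open>n\<close>: a stable vertex is a row, a clique vertex a column, and \<open>h\<close> is the sum of \<open>f\<close> over the row
  lengths plus the sum of \<open>f (N + c)\<close> over the column heights \<open>c\<close>, where \<open>N = n\<close> once the forced full
  row is set aside. By induction, this is largest when the rows are filled one after the other: a
  further full row is removed by passing to \<open>N + 1\<close>, and if there is none then some column is empty and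
  is removed by passing to width \<open>n - 1\<close>.

  It remains to see that the row-filled diagram of width \<open>p + 1 \<le> N\<close> beats the one of width \<open>p\<close> with
  the same number \<open>M\<close> of cells. If the latter has at most \<open>p\<close> full rows, its last cells are moved into the new
  column one by one, and each pair of moves is compared using that \<open>f (x + 1) - f x\<close> is increasing and
  concave. For taller diagrams the continuous approximation gains at least
  \<open>N ln (1 + M / ((p + 1) N))\<close>, which exceeds the rounding errors: at most \<open>(p + 1) / e\<close> from the
  incomplete row and a bounded amount from the unequal columns.
\<close>

subsection \<open>Increments of \<open>x ln x\<close>\<close>

text \<open>By convexity the graph of \<open>xlogx\<close> lies above its tangent at
  \<open>c\<close>, whose slope is \<open>ln c + 1\<close>; the inequality behind it is
  \<open>ln_le_minus_one\<close> at \<open>c / t\<close>.\<close>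

lemma xlogx_tangent_le:
  assumes "0 \<le> t" "0 < c"
  shows "t * ln c + t - c \<le> xlogx t"
proof (cases "t = 0")
  case False
  then have t: "t > 0" using assms by simp
  have "ln (c / t) \<le> c / t - 1" using t assms by (intro ln_le_minus_one) simp
  then have "t * ln (c / t) \<le> t * (c / t - 1)" using t by simp
  then show ?thesis using t assms by (simp add: xlogx_def ln_div algebra_simps)
qed (use assms in \<open>simp add: xlogx_def\<close>)

text \<open>The counterpart of the tangent bound: \<open>ln_le_minus_one\<close> at
  \<open>t / c\<close> shows that \<open>xlogx\<close> exceeds its tangent at \<open>c\<close> by at
  most the quadratic term.\<close>

lemma xlogx_le_parabola:
  assumes "0 \<le> t" "0 < c"
  shows "xlogx t \<le> t * ln c + (t - c) + (t - c)\<^sup>2 / c"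
proof -
  have "xlogx t \<le> t * ln c + t * (t / c - 1)"
  proof (cases "t = 0")
    case False
    then have t: "t > 0" using assms by simp
    have "ln (t / c) \<le> t / c - 1" using t assms by (intro ln_le_minus_one) simp
    then have "t * ln (t / c) \<le> t * (t / c - 1)" using t by simp
    then show ?thesis using t assms by (simp add: xlogx_def ln_div algebra_simps)
  qed (simp add: xlogx_def)
  also have "t * (t / c - 1) = (t - c) + (t - c)\<^sup>2 / c"
    using assms by (simp add: field_simps power2_eq_square)
  finally show ?thesis by simp
qed

abbreviation nxlogx :: "nat \<Rightarrow> real" where
  "nxlogx n \<equiv> xlogx (real n)"

definition incr :: "nat \<Rightarrow> real" where
  "incr n = nxlogx (Suc n) - nxlogx n"

lemma nxlogx_diff_eq_sum_incr: "nxlogx (u + t) - nxlogx u = (\<Sum>i<t. incr (u + i))"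
  by (induction t) (simp_all add: incr_def)

text \<open>Convexity in discrete form: the tangent at \<open>n + 1\<close> bounds the values at
  \<open>n\<close> and \<open>n + 2\<close> from below, and the two bounds are added.\<close>

lemma incr_mono_Suc: "incr n \<le> incr (Suc n)"
proof -
  have "real n * ln (real n + 1) + real n - (real n + 1) \<le> xlogx (real n)"
    by (rule xlogx_tangent_le) auto
  moreover have "(real n + 2) * ln (real n + 1) + (real n + 2) - (real n + 1) \<le> xlogx (real n + 2)"
    by (rule xlogx_tangent_le) auto
  ultimately show ?thesis
    by (simp add: incr_def xlogx_def algebra_simps)
qed

lemma incr_mono: "m \<le> n \<Longrightarrow> incr m \<le> incr n"
  by (rule lift_Suc_mono_le[of incr]) (rule incr_mono_Suc)

lemma incr_concave_Suc: "incr (Suc (Suc n)) - incr (Suc n) \<le> incr (Suc n) - incr n"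
\<comment> \<open>The derivative argument would start at 0, where x ln x is not differentiable, so
  \<open>n = 0\<close> is computed directly.\<close>
proof (cases "n = 0")
  case True
  have "ln (3::real) \<le> ln 4" by simp
  also have "ln (4::real) = 2 * ln 2" using ln_mult[of "2::real" 2] by simp
  finally show ?thesis using True by (simp add: incr_def xlogx_def)
next
  case False
  \<comment> \<open>The second difference of x ln x; the claim is that it decreases from
    \<open>n\<close> to \<open>n + 1\<close>.\<close>
  define q where "q x = (x + 2) * ln (x + 2) - 2 * ((x + 1) * ln (x + 1)) + x * ln x" for x :: real
  have "q (real n + 1) \<le> q (real n)"
  proof (rule DERIV_nonpos_imp_nonincreasing[of "real n" "real n + 1" q])
    fix x :: real assume "real n \<le> x" "x \<le> real n + 1"
    then have x: "x > 0" using False by linarith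
    have d: "(q has_real_derivative ln (x + 2) - 2 * ln (x + 1) + ln x) (at x)"
      unfolding q_def using x by (auto intro!: derivative_eq_intros)
    have "ln ((x + 2) * x) \<le> ln ((x + 1) * (x + 1))"
      using x by (intro ln_mono) (simp_all add: algebra_simps add_pos_pos)
    then have "ln (x + 2) - 2 * ln (x + 1) + ln x \<le> 0"
      using x by (simp add: ln_mult)
    with d show "\<exists>y. (q has_real_derivative y) (at x) \<and> y \<le> 0" by blast
  qed simp
  then show ?thesis by (simp add: q_def incr_def xlogx_def algebra_simps)
qed

lemma incr_concave:
  assumes "p \<le> q"
  shows "incr (q + d) - incr q \<le> incr (p + d) - incr p"
proof -
  have dec: "incr (Suc q) - incr q \<le> incr (Suc p) - incr p" if "p \<le> q" for p q
    using that
  proof (induction rule: dec_induct)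
    case (step n) then show ?case using incr_concave_Suc[of n] by linarith
  qed simp
  show ?thesis
  proof (induction d)
    case (Suc d)
    then show ?case using dec[of "p + d" "q + d"] assms by simp
  qed simp
qed

text \<open>Each side is a sum over s = 1, ..., \<open>t\<close> of
  \<open>incr v - incr (v - s)\<close>, respectively the same with \<open>u\<close>, and
  \<open>incr_concave\<close> compares the sums term by term. With \<open>v\<close> a column value
  and \<open>u\<close> a row length, this weighs the loss in the old columns against the gain in the
  rows.\<close>

lemma row_transfer_gain_antimono:
  assumes "t \<le> u" "u \<le> v"
  shows "real t * incr v - (nxlogx v - nxlogx (v - t)) \<le> real t * incr u - (nxlogx u - nxlogx (u - t))"
  using assms(1)
proof (induction t)
  case (Suc t)
  have "incr (v - Suc t + Suc t) - incr (v - Suc t) \<le> incr (u - Suc t + Suc t) - incr (u - Suc t)"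
    using assms Suc.prems by (intro incr_concave) auto
  then have "incr v - incr (v - Suc t) \<le> incr u - incr (u - Suc t)"
    using assms Suc.prems by simp
  moreover have "nxlogx (v - t) = nxlogx (v - Suc t) + incr (v - Suc t)"
    using assms Suc.prems by (simp add: incr_def Suc_diff_Suc)
  moreover have "nxlogx (u - t) = nxlogx (u - Suc t) + incr (u - Suc t)"
    using assms Suc.prems by (simp add: incr_def Suc_diff_Suc)
  ultimately show ?case using Suc by (simp add: algebra_simps)
qed simp

subsection \<open>Row-filled diagrams\<close>

text \<open>
  The value of the diagram of width \<open>n\<close> with \<open>a\<close> full rows and one more row of length \<open>b\<close>.
\<close>
definition packed :: "nat \<Rightarrow> nat \<Rightarrow> nat \<Rightarrow> nat \<Rightarrow> real" where
  "packed N n a b = real a * nxlogx n + nxlogx b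
     + real b * nxlogx (N + a + 1) + (real n - real b) * nxlogx (N + a)"

text \<open>The term \<open>nxlogx N\<close> on the left is the value of the empty column that the
  wider diagram fills. Each moved cell lengthens a full row and the new column, and shortens a last
  row and an old column; these four effects are balanced.\<close>

lemma packed_widen_short:
  assumes eq: "a' * p + b' = a * Suc p + b" and b': "b' < p" and b: "b \<le> p"
    and N: "Suc p \<le> N" and a': "a' \<le> p"
  shows "packed N p a' b' + nxlogx N \<le> packed N (Suc p) a b"
proof (cases "a' \<le> b'")
  case True
  \<comment> \<open>The incomplete row supplies one cell to each of the \<open>a'\<close> full rows,
    so the number of full rows is unchanged.\<close>
  have e2: "a * Suc p + b = a' * Suc p + (b' - a')" using eq True by simp
  have "a = (a * Suc p + b) div Suc p" using b by (simp del: mult_Suc_right)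
  also have "\<dots> = a'" unfolding e2 using b' by (simp del: mult_Suc_right)
  finally have a: "a = a'" .
  then have bb: "b = b' - a'" using e2 by simp
  have "nxlogx b' - nxlogx (b' - a') \<le> nxlogx p - nxlogx (p - a')"
  proof -
    have "(\<Sum>i<a'. incr (b' - a' + i)) \<le> (\<Sum>i<a'. incr (p - a' + i))"
      using b' by (intro sum_mono incr_mono) auto
    then show ?thesis
      using nxlogx_diff_eq_sum_incr[of "b' - a'" a'] nxlogx_diff_eq_sum_incr[of "p - a'" a'] True a' by simp
  qed
  moreover have "real a' * incr (N + a') - (nxlogx (N + a') - nxlogx (N + a' - a'))
      \<le> real a' * incr p - (nxlogx p - nxlogx (p - a'))"
    using a' N by (intro row_transfer_gain_antimono) auto
  ultimately show ?thesis unfolding packed_def a bb incr_def using True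
    by (simp add: algebra_simps)
next
  case False
  \<comment> \<open>The incomplete row is used up after \<open>b'\<close> moves. The last full row
    then becomes the incomplete one and supplies the remaining \<open>x\<close> cells to the other
    full rows.\<close>
  define x where "x = a' - 1 - b'"
  have e2: "a * Suc p + b = (a' - 1) * Suc p + (p - x)"
    using eq False a' b' by (cases a') (auto simp: x_def)
  have "a = (a * Suc p + b) div Suc p" using b by (simp del: mult_Suc_right)
  also have "\<dots> = a' - 1" unfolding e2 by (simp del: mult_Suc_right)
  finally have a: "a = a' - 1" .
  then have bb: "b = p - x" using e2 by simp
  have xp: "x \<le> p" using a' by (simp add: x_def)
  have 1: "real x * incr (N + a) - (nxlogx (N + a) - nxlogx (N + a - x))
      \<le> real x * incr p - (nxlogx p - nxlogx (p - x))"
    using xp N by (intro row_transfer_gain_antimono) auto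
  have nx: "N + a - x = N + b'" using False by (simp add: a x_def)
  have "(\<Sum>j<b'. incr (N + a') - incr (N + j)) \<le> (\<Sum>j<b'. incr p - incr j)"
  proof (intro sum_mono)
    fix j assume "j \<in> {..<b'}"
    then have j: "j \<le> p" using b' by simp
    \<comment> \<open>Here \<open>a' \<le> p\<close> enters: it bounds the column value by
      \<open>N + p\<close>, after which concavity removes the shift by \<open>N\<close>.\<close>
    have "incr (N + a') \<le> incr (N + j + (p - j))" using a' j by (intro incr_mono) simp
    moreover have "incr (N + j + (p - j)) - incr (N + j) \<le> incr (j + (p - j)) - incr j"
      by (rule incr_concave) simp
    ultimately show "incr (N + a') - incr (N + j) \<le> incr p - incr j" using j by simp
  qed
  then have 2: "real b' * incr (N + a') - (nxlogx (N + b') - nxlogx N) \<le> real b' * incr p - nxlogx b'"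
    using nxlogx_diff_eq_sum_incr[of 0 b'] nxlogx_diff_eq_sum_incr[of N b']
    by (simp add: sum_subtractf xlogx_def)
  have A: "a' = Suc a" using False a by simp
  have B: "a = x + b'" using False a x_def by simp
  show ?thesis using 1 2 xp unfolding packed_def bb nx A incr_def B
    by (simp add: algebra_simps)
qed


section \<open>Continuous approximation and the widening step for tall diagrams\<close>

lemma ln_one_plus_ge_pade:
  assumes "0 \<le> (z::real)"
  shows "2 * z / (2 + z) \<le> ln (1 + z)"
proof -
  define g where "g x = (2 + x) * ln (1 + x) - 2 * x" for x :: real
  have "g 0 \<le> g z"
  proof (rule DERIV_nonneg_imp_nondecreasing[of 0 z g])
    fix x :: real assume "0 \<le> x" "x \<le> z"
    then have d: "(g has_real_derivative ln (1 + x) + (2 + x) / (1 + x) - 2) (at x)"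
      unfolding g_def by (auto intro!: derivative_eq_intros)
    have "ln (1 / (1 + x)) \<le> 1 / (1 + x) - 1" using \<open>0 \<le> x\<close> by (intro ln_le_minus_one) simp
    then have "0 \<le> ln (1 + x) + (2 + x) / (1 + x) - 2"
      using \<open>0 \<le> x\<close> by (simp add: ln_div field_simps)
    with d show "\<exists>y. (g has_real_derivative y) (at x) \<and> 0 \<le> y" by blast
  qed (use assms in simp)
  then show ?thesis using assms by (simp add: g_def field_simps)
qed

text \<open>All columns are bounded by tangents at their mean value \<open>A / n\<close>, so the
  linear deviations cancel. Only the incomplete row loses against \<open>b * ln n\<close>, by at
  most n / e, which is at most 2n / 5.\<close>

lemma packed_ge:
  assumes b: "b \<le> n" and n: "0 < n" and M: "M = real a * real n + real b"
    and N: "0 < N" and A: "A = real n * real N + M"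
  shows "M * ln n - 2 / 5 * n + A * ln (A / n) \<le> packed N n a b"
proof -
  have Apos: "A > 0" using n N unfolding A M by (simp add: add_pos_nonneg)
  define c where "c = A / n"
  have c: "c > 0" using Apos n by (simp add: c_def)
  have e: "5 / 2 \<le> exp (1::real)" using exp_lower_Taylor_quadratic[of 1] by simp
  have "real b * ln n - 2 / 5 * n \<le> nxlogx b"
  proof -
    \<comment> \<open>The tangent point \<open>n / exp 1\<close> minimises b ln b - b ln n over real
      b.\<close>
    have "real b * ln (n / exp 1) + real b - n / exp 1 \<le> nxlogx b"
      using n by (intro xlogx_tangent_le) auto
    moreover have "real b * ln (n / exp 1) = real b * ln n - real b"
      using n by (simp add: ln_div algebra_simps)
    moreover have "real n / exp 1 \<le> real n / (5 / 2)"
      using e n by (intro divide_left_mono) auto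
    then have "real n / exp 1 \<le> 2 / 5 * n" by simp
    ultimately show ?thesis by linarith
  qed
  moreover have "real b * (real (N + a + 1) * ln c + real (N + a + 1) - c) \<le> real b * nxlogx (N + a + 1)"
    using c by (intro mult_left_mono xlogx_tangent_le) auto
  moreover have "(real n - real b) * (real (N + a) * ln c + real (N + a) - c) \<le> (real n - real b) * nxlogx (N + a)"
    using c b by (intro mult_left_mono xlogx_tangent_le) auto
  moreover have "real b * (real (N + a + 1) * ln c + real (N + a + 1) - c)
      + (real n - real b) * (real (N + a) * ln c + real (N + a) - c) = A * ln c + (A - n * c)"
    unfolding A M by (simp add: algebra_simps)
  moreover have "n * c = A" using n by (simp add: c_def)
  moreover have "real a * nxlogx n = real a * n * ln n" by (simp add: xlogx_def)
  ultimately have "real a * n * ln n + real b * ln n - 2 / 5 * n + A * ln c \<le> packed N n a b"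
    unfolding packed_def by linarith
  then show ?thesis unfolding M c_def by (simp add: algebra_simps)
qed

text \<open>The parabola bound is taken at the mean column value \<open>B / p\<close>: the linear
  deviations cancel again, and the squared ones sum to b(p - b) / p, which gives the error term. The
  incomplete row is bounded by \<open>b * ln p\<close>.\<close>

lemma packed_le:
  assumes b: "b \<le> p" and p: "0 < p" and M: "M = real a * real p + real b"
    and N: "0 < N" and B: "B = real p * real N + M"
  shows "packed N p a b \<le> M * ln p + B * ln (B / p) + real b * (real p - real b) / B"
proof -
  have Bpos: "B > 0" using p N unfolding B M by (simp add: add_pos_nonneg)
  define c where "c = B / p"
  have c: "c > 0" using Bpos p by (simp add: c_def)
  have c2: "c = real N + real a + real b / real p"
    using p unfolding c_def B M by (simp add: field_simps)
  have "real b * ln b \<le> real b * ln p" using b p by (cases "b = 0") (auto intro!: mult_left_mono)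
  then have "nxlogx b \<le> real b * ln p" by (simp add: xlogx_def)
  moreover have "real b * nxlogx (N + a + 1) \<le> real b * (real (N + a + 1) * ln c + (real (N + a + 1) - c) + (real (N + a + 1) - c)\<^sup>2 / c)"
    using c by (intro mult_left_mono xlogx_le_parabola) auto
  moreover have "(real p - real b) * nxlogx (N + a) \<le> (real p - real b) * (real (N + a) * ln c + (real (N + a) - c) + (real (N + a) - c)\<^sup>2 / c)"
    using c b by (intro mult_left_mono xlogx_le_parabola) auto
  moreover have "real b * (real (N + a + 1) * ln c + (real (N + a + 1) - c) + (real (N + a + 1) - c)\<^sup>2 / c)
      + (real p - real b) * (real (N + a) * ln c + (real (N + a) - c) + (real (N + a) - c)\<^sup>2 / c)
     = B * ln c + (B - p * c) + (real b * (real (N + a + 1) - c)\<^sup>2 + (real p - real b) * (real (N + a) - c)\<^sup>2) / c"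
    unfolding B M by (simp add: algebra_simps add_divide_distrib diff_divide_distrib)
  moreover have "(real b * (real (N + a + 1) - c)\<^sup>2 + (real p - real b) * (real (N + a) - c)\<^sup>2) / c
      = real b * (real p - real b) / B"
  proof -
    have "real b * (real (N + a + 1) - c)\<^sup>2 + (real p - real b) * (real (N + a) - c)\<^sup>2
        = real b * (real p - real b) / p"
      unfolding c2 using p by (simp add: field_simps power2_eq_square)
    then show ?thesis using p by (simp add: c_def)
  qed
  moreover have "p * c = B" using p by (simp add: c_def)
  moreover have "real a * nxlogx p = real a * p * ln p" by (simp add: xlogx_def)
  ultimately have "packed N p a b \<le> real a * p * ln p + real b * ln p + B * ln c + real b * (real p - real b) / B"
    unfolding packed_def by linarith
  then show ?thesis unfolding M c_def by (simp add: algebra_simps)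
qed

text \<open>\<open>A\<close> and \<open>B\<close> are the column totals for widths
  \<open>p + 1\<close> and \<open>p\<close>, and \<open>c\<close> is the ratio of the mean column
  values \<open>B / p\<close> and \<open>A / (p + 1)\<close>. Jensen's inequality bounds c ln c, and
  scaling by A p / (p + 1) turns this into the claim.\<close>

lemma smooth_widen_gain:
  fixes M N p :: real
  assumes "0 < M" "0 < N" "0 < p"
  defines "A \<equiv> (p + 1) * N + M" and "B \<equiv> p * N + M"
  shows "M * ln p + B * ln (B / p) + N * ln (A / (p + 1)) \<le> M * ln (p + 1) + A * ln (A / (p + 1))"
proof -
  have AB: "A > 0" "B > 0" using assms by (simp_all add: A_def B_def add_pos_pos)
  \<comment> \<open>In this form \<open>c\<close> is the convex combination of
    \<open>1 + 1 / p\<close> and 1 with weights \<open>M / A\<close> and \<open>1 - M / A\<close>;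
    the second point contributes nothing because 1 ln 1 = 0.\<close>
  define c where "c = 1 + (M / A) * (1 / p)"
  have c: "c = (p + 1) * B / (p * A)"
    using AB assms(3) unfolding c_def by (simp add: field_simps) (simp add: A_def B_def algebra_simps)
  have c0: "c > 0" using AB assms c by simp
  have l: "0 \<le> M / A" "M / A \<le> 1" using AB assms by (simp_all add: A_def)
  have "(M / A) * ((1 + 1 / p) * ln c + (1 + 1 / p) - c) \<le> (M / A) * xlogx (1 + 1 / p)"
    using c0 l assms by (intro mult_left_mono xlogx_tangent_le) auto
  moreover have "(1 - M / A) * (1 * ln c + 1 - c) \<le> (1 - M / A) * xlogx 1"
    using c0 l assms by (intro mult_left_mono xlogx_tangent_le) auto
  moreover have "(M / A) * ((1 + 1 / p) * ln c + (1 + 1 / p) - c) + (1 - M / A) * (1 * ln c + 1 - c)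
      = (1 + (M / A) * (1 / p)) * ln c + (1 + (M / A) * (1 / p)) - c"
    by (simp add: algebra_simps)
  ultimately have "c * ln c \<le> (M / A) * xlogx (1 + 1 / p)"
    unfolding c_def[symmetric] by (simp add: xlogx_def)
  also have "1 + 1 / p = (p + 1) / p" using assms by (simp add: field_simps)
  finally have "A * p / (p + 1) * (c * ln c) \<le> A * p / (p + 1) * ((M / A) * xlogx ((p + 1) / p))"
    using AB assms by (intro mult_left_mono) auto
  moreover have "A * p / (p + 1) * (c * ln c) = B * ln c"
  proof -
    have "A * p / (p + 1) * c = B" using AB assms(3) unfolding c by simp
    then show ?thesis by (metis mult.assoc)
  qed
  moreover have "A * p / (p + 1) * ((M / A) * xlogx ((p + 1) / p)) = M * ln ((p + 1) / p)"
    using AB assms(3) unfolding xlogx_def by (simp add: divide_simps)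
  moreover have "ln c = ln (B / p) - ln (A / (p + 1))"
    using AB assms(3) unfolding c by (simp add: ln_mult ln_div)
  moreover have "ln ((p + 1) / p) = ln (p + 1) - ln p" using assms by (simp add: ln_div)
  ultimately have "B * (ln (B / p) - ln (A / (p + 1))) \<le> M * (ln (p + 1) - ln p)" by simp
  moreover have "A = B + N" by (simp add: A_def B_def algebra_simps)
  ultimately show ?thesis by (simp add: algebra_simps)
qed

lemma packed_widen_tall:
  assumes eq: "a' * p + b' = a * Suc p + b" and b': "b' < p" and b: "b \<le> p"
    and N: "Suc p \<le> N" and a': "Suc p \<le> a'"
  shows "packed N p a' b' + nxlogx N \<le> packed N (Suc p) a b"
proof -
  define M where "M = real a' * real p + real b'"
  define A where "A = (real p + 1) * N + M"
  define B where "B = real p * N + M"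
  have p: "0 < p" using b' by simp
  have M2: "M = real a * (real p + 1) + real b"
    using arg_cong[OF eq, of real] by (simp add: M_def algebra_simps)
  have "(real p + 1) * real p \<le> real a' * real p" using a' by (intro mult_right_mono) auto
  then have Mge: "(real p + 1) * real p \<le> M" by (simp add: M_def)
  moreover have "0 < (real p + 1) * real p" using p by simp
  ultimately have Mpos: "0 < M" by linarith
  have N1: "real p + 1 \<le> N" using N by simp
  have Npos: "0 < real N" using N by simp
  have up: "packed N p a' b' \<le> M * ln p + B * ln (B / p) + real b' * (real p - real b') / B"
    using b' p N by (intro packed_le) (auto simp: M_def B_def)
  have low: "M * ln (p + 1) - 2 / 5 * (p + 1) + A * ln (A / (p + 1)) \<le> packed N (Suc p) a b"
    using packed_ge[of b "Suc p" M a N A] b N M2 by (simp add: A_def algebra_simps)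
  have gain: "M * ln p + B * ln (B / p) + N * ln (A / (p + 1)) \<le> M * ln (p + 1) + A * ln (A / (p + 1))"
    using smooth_widen_gain[OF Mpos Npos, of p] p unfolding A_def B_def by (simp add: add.commute)
  \<comment> \<open>The numerator bound is crude but vanishes for \<open>p = 1\<close>, where the
    final comparison has no slack.\<close>
  have err: "real b' * (real p - real b') / B \<le> (real p - 1) / (2 * (real p + 1))"
  proof -
    have "real b' * (real p - real b') \<le> (real p - 1) * real p" using b' by (intro mult_mono) auto
    moreover have "2 * (real p + 1) * real p \<le> B"
      using Mge mult_left_mono[OF N1, of "real p"] unfolding B_def by (simp add: algebra_simps)
    moreover have "0 \<le> (real p - 1) * real p" using p by simp
    moreover have "0 < 2 * (real p + 1) * real p" using p by simp
    ultimately have "real b' * (real p - real b') / B \<le> (real p - 1) * real p / (2 * (real p + 1) * real p)"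
      by (intro frac_le) auto
    then show ?thesis using p by simp
  qed
  \<comment> \<open>The mean column value \<open>A / (p + 1)\<close> equals N(1 + z), so the gain
    beyond \<open>nxlogx N\<close> is N ln(1 + z).\<close>
  define z where "z = M / ((real p + 1) * N)"
  have zM: "z * ((real p + 1) * N) = M" using Npos by (simp add: z_def)
  then have "A = (real p + 1) * (N * (1 + z))" unfolding A_def by (simp add: algebra_simps)
  then have "A / (p + 1) = N * (1 + z)" by (simp add: add.commute)
  moreover have z: "0 \<le> z" using Mpos by (simp add: z_def)
  ultimately have lnA: "ln (A / (p + 1)) = ln N + ln (1 + z)" using Npos by (simp add: ln_mult)
  have "2 * (real p + 1) * real p / (3 * real p + 2) \<le> N * (2 * z / (2 + z))"
  proof -
    have e: "N * (2 * z / (2 + z)) = 2 * N * M / (2 * (real p + 1) * N + M)"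
    proof -
      have "2 * N * M / (2 * (real p + 1) * N + M) = (2 * N * z) * ((real p + 1) * N) / ((2 + z) * ((real p + 1) * N))"
        unfolding zM[symmetric] by (simp add: algebra_simps)
      also have "\<dots> = 2 * N * z / (2 + z)" using Npos by (subst mult_divide_mult_cancel_right) auto
      finally show ?thesis by simp
    qed
    \<comment> \<open>The Pade bound increases in both \<open>N\<close> and \<open>M\<close>, so it
      is smallest at N = p + 1 and M = p(p + 1). This expression is the cross-multiplied difference,
      sorted by the two excesses.\<close>
    have "0 \<le> 4 * ((real p + 1) * N) * (M - (real p + 1) * real p) + 2 * (real p * M) * (N - (real p + 1))"
      using Mge N1 Mpos by (intro add_nonneg_nonneg mult_nonneg_nonneg) auto
    then have "2 * (real p + 1) * real p * (2 * (real p + 1) * N + M) \<le> 2 * N * M * (3 * real p + 2)"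
      by (simp add: algebra_simps)
    moreover have "0 < 2 * (real p + 1) * N + M" using Mpos Npos by (intro add_pos_pos) auto
    ultimately show ?thesis unfolding e by (simp add: divide_le_eq pos_le_divide_eq field_simps)
  qed
  also have "\<dots> \<le> N * ln (1 + z)" using ln_one_plus_ge_pade[OF z] by (intro mult_left_mono) auto
  finally have big: "2 * (real p + 1) * real p / (3 * real p + 2) \<le> N * ln (1 + z)" .
  \<comment> \<open>Equality holds at \<open>p = 1\<close>, so the constant 2/5 leaves no room
    there; this explains the factor \<open>real p - 1\<close> in the difference.\<close>
  have fin: "2 / 5 * (real p + 1) + (real p - 1) / (2 * (real p + 1)) \<le> 2 * (real p + 1) * real p / (3 * real p + 2)"
  proof -
    have "2 * (real p + 1) * real p / (3 * real p + 2) - 2 / 5 * (real p + 1) - (real p - 1) / (2 * (real p + 1))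
       = (real p - 1) * (8 * (real p + 1)\<^sup>2 - 5 * (3 * real p + 2)) / (10 * (3 * real p + 2) * (real p + 1))"
      by (simp add: divide_simps add_eq_0_iff) (auto simp: algebra_simps power2_eq_square)
    also have "\<dots> \<ge> 0"
    proof -
      have "1 \<le> real p" using p by simp
      then have "1 \<le> (real p)\<^sup>2" by (rule one_le_power)
      then have "0 \<le> 8 * (real p + 1)\<^sup>2 - 5 * (3 * real p + 2)"
        using \<open>1 \<le> real p\<close> by (simp add: power2_eq_square algebra_simps)
      then show ?thesis using \<open>1 \<le> real p\<close> by (intro divide_nonneg_nonneg mult_nonneg_nonneg) auto
    qed
    finally show ?thesis by simp
  qed
  have "nxlogx N = N * ln N" by (simp add: xlogx_def)
  then show ?thesis using up low gain err big fin unfolding lnA by (simp add: distrib_left)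
qed


lemma packed_widen:
  assumes "a' * p + b' = a * Suc p + b" "b' < p" "b \<le> p" "Suc p \<le> N"
  shows "packed N p a' b' + nxlogx N \<le> packed N (Suc p) a b"
  using packed_widen_short[OF assms] packed_widen_tall[OF assms] by (cases "a' \<le> p") auto

subsection \<open>Optimality of row-filling among nested families\<close>

text \<open>A nonempty finite chain contains its own union, so the union is itself one of the proper
  subsets of \<open>K\<close>.\<close>

lemma chain_misses_point:
  assumes "finite S" "K \<noteq> {}"
    and sub: "\<And>j. j \<in> S \<Longrightarrow> A j \<subset> K"
    and chain: "\<And>i j. i \<in> S \<Longrightarrow> j \<in> S \<Longrightarrow> A i \<subseteq> A j \<or> A j \<subseteq> A i"
  shows "\<exists>v\<in>K. \<forall>j\<in>S. v \<notin> A j"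
proof -
  have "\<Union>(A ` S) \<subset> K"
  proof (cases "S = {}")
    case False
    have "\<Union>(A ` S) \<in> A ` S"
      using assms(1) False chain by (intro Union_in_chain) (auto simp: subset_chain_def)
    then show ?thesis using sub by auto
  qed (use assms(2) in auto)
  then show ?thesis by blast
qed

text \<open>The value of a diagram with rows \<open>A j\<close> and columns indexed by
  \<open>K\<close>. The base value \<open>N\<close> records what every column has gained outside the
  diagram: clique neighbours and full rows already stripped off.\<close>

definition profile :: "nat \<Rightarrow> 'b set \<Rightarrow> 'a set \<Rightarrow> ('a \<Rightarrow> 'b set) \<Rightarrow> real" where
  "profile N K S A = (\<Sum>j\<in>S. nxlogx (card (A j))) + (\<Sum>i\<in>K. nxlogx (N + card {j\<in>S. i \<in> A j}))"

lemma profile_remove_full: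
  assumes "finite S" "j \<in> S" "A j = K"
  shows "profile N K S A = nxlogx (card K) + profile (Suc N) K (S - {j}) A"
proof -
  have "card {l\<in>S. i \<in> A l} = Suc (card {l\<in>S - {j}. i \<in> A l})" if "i \<in> K" for i
  proof -
    have "{l\<in>S. i \<in> A l} = insert j {l\<in>S - {j}. i \<in> A l}" using assms that by auto
    then show ?thesis using assms(1) by simp
  qed
  then show ?thesis using assms by (simp add: profile_def sum.remove)
qed

lemma profile_remove_unused:
  assumes "finite K" "i \<in> K" "\<And>j. j \<in> S \<Longrightarrow> i \<notin> A j"
  shows "profile N K S A = nxlogx N + profile N (K - {i}) S A"
proof -
  have "{j\<in>S. i \<in> A j} = {}" using assms(3) by blast
  then have "card {j\<in>S. i \<in> A j} = 0" by (simp only: card.empty)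
  then show ?thesis using assms(1,2) by (simp add: profile_def sum.remove)
qed

text \<open>Stripping a full row raises \<open>N\<close>; if no row is full, nesting leaves some
  column empty, and dropping it lowers \<open>card K\<close>. So \<open>card K \<le> N\<close>
  persists, as \<open>packed_widen\<close> requires when the dropped column is restored.\<close>

lemma profile_le_packed:
  assumes "finite K" "finite S" "card K \<le> N" "a * card K + b = (\<Sum>j\<in>S. card (A j))"
    and "b < card K \<or> K = {} \<and> b = 0"
    and "\<And>j. j \<in> S \<Longrightarrow> A j \<subseteq> K"
    and "\<And>i j. i \<in> S \<Longrightarrow> j \<in> S \<Longrightarrow> A i \<subseteq> A j \<or> A j \<subseteq> A i"
  shows "profile N K S A \<le> packed N (card K) a b"
  using assms
proof (induction "card K + card S" arbitrary: K S N a b rule: less_induct)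
  case less
  note fK = less.prems(1) and fS = less.prems(2) and KN = less.prems(3) and M = less.prems(4)
    and b = less.prems(5) and sub = less.prems(6) and chain = less.prems(7)
  show ?case
  proof (cases "K = {}")
    case True
    then have "A j = {}" if "j \<in> S" for j using sub that by auto
    then show ?thesis using True b by (simp add: profile_def packed_def xlogx_def)
  next
    case False
    then have bK: "b < card K" using b by simp
    show ?thesis
    proof (cases "\<exists>j\<in>S. A j = K")
      case True
      then obtain j where j: "j \<in> S" "A j = K" by blast
      have sum: "(\<Sum>l\<in>S. card (A l)) = card K + (\<Sum>l\<in>S - {j}. card (A l))"
        using j fS by (simp add: sum.remove)
      have a: "a > 0"
      proof (rule ccontr)
        assume "\<not> a > 0"
        then show False using M sum bK by simp
      qed
      then have "profile (Suc N) K (S - {j}) A \<le> packed (Suc N) (card K) (a - 1) b"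
        using less.prems j sum bK fS card_Diff1_less[OF fS j(1)]
        by (intro less.hyps) (auto simp: algebra_simps diff_mult_distrib)
      moreover have "packed N (card K) a b = nxlogx (card K) + packed (Suc N) (card K) (a - 1) b"
        using a by (cases a) (simp_all add: packed_def algebra_simps)
      ultimately show ?thesis using profile_remove_full[of S j A K N] fS j by simp
    next
      case nofull: False
      then have "\<exists>v\<in>K. \<forall>j\<in>S. v \<notin> A j"
        using fS False sub chain by (intro chain_misses_point) blast+
      then obtain i where i: "i \<in> K" "\<And>j. j \<in> S \<Longrightarrow> i \<notin> A j" by blast
      define K' where "K' = K - {i}"
      \<comment> \<open>If \<open>K'\<close> is empty, division by zero gives \<open>a' = 0\<close>
        and \<open>b'\<close> is the whole sum, which is 0 because all rows are then empty.\<close>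
      define a' where "a' = (\<Sum>j\<in>S. card (A j)) div card K'"
      define b' where "b' = (\<Sum>j\<in>S. card (A j)) mod card K'"
      have cK: "card K = Suc (card K')" using fK i unfolding K'_def by (metis card_Suc_Diff1)
      have fK': "finite K'" using fK by (simp add: K'_def)
      have sub': "A j \<subseteq> K'" if "j \<in> S" for j using sub i that unfolding K'_def by blast
      have M0: "(\<Sum>j\<in>S. card (A j)) = 0" if "K' = {}" using sub' that by (auto intro!: sum.neutral)
      have M': "a' * card K' + b' = (\<Sum>j\<in>S. card (A j))" by (simp add: a'_def b'_def)
      have b'K: "b' < card K' \<or> K' = {} \<and> b' = 0"
        using fK' M0 by (cases "K' = {}") (auto simp: b'_def card_gt_0_iff)
      have "profile N K' S A \<le> packed N (card K') a' b'"
        using fK' fS KN cK M' b'K sub' chain by (intro less.hyps) auto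
      moreover have "packed N (card K') a' b' + nxlogx N \<le> packed N (Suc (card K')) a b"
      proof (cases "K' = {}")
        case True
        then have "a' = 0" "b' = 0" "a = 0" "b = 0" using M0 M cK by (simp_all add: a'_def b'_def)
        then show ?thesis using True by (simp add: packed_def xlogx_def)
      next
        case False
        then show ?thesis using M M' b'K bK KN cK by (intro packed_widen) auto
      qed
      moreover have "profile N K S A = nxlogx N + profile N K' S A"
        unfolding K'_def using fK i by (rule profile_remove_unused)
      ultimately show ?thesis unfolding cK by linarith
    qed
  qed
qed

subsection \<open>Split graphs\<close>

locale split_graph =
  fixes G :: "'a ugraph" and K S :: "'a set"
  assumes simple: "simple_graph G"
    and part: "K \<union> S = uverts G" "K \<inter> S = {}"
    and clique: "is_clique G K" and stable: "is_stable G S"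
begin

lemma finite_parts: "finite K" "finite S"
  using simple part unfolding simple_graph_def by (metis finite_Un)+

lemma nbhd_stable: "j \<in> S \<Longrightarrow> nbhd G j \<subseteq> K"
  using stable part unfolding nbhd_def is_stable_def by blast

lemma no_loop: "{v, v} \<notin> uedges G"
  using simple unfolding simple_graph_def by force

lemma in_nbhd: "i \<in> K \<Longrightarrow> {i, j} \<in> uedges G \<longleftrightarrow> i \<in> nbhd G j"
  using part by (auto simp: nbhd_def)

lemma degree_clique:
  assumes "i \<in> K"
  shows "degree G i = card K - 1 + card {j\<in>S. i \<in> nbhd G j}"
proof -
  have "nbhd G i = (K - {i}) \<union> {j\<in>S. i \<in> nbhd G j}"
    using assms part clique no_loop unfolding is_clique_def nbhd_def
    by (auto simp: insert_commute)
  moreover have "card \<dots> = card (K - {i}) + card {j\<in>S. i \<in> nbhd G j}"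
    using finite_parts part by (intro card_Un_disjoint) auto
  ultimately show ?thesis using assms by (simp add: degree_def)
qed

text \<open>The base value \<open>card K - 1\<close> is one short of what
  \<open>profile_le_packed\<close> asks for; stripping one full row makes up the difference.\<close>

lemma h_eq_profile: "h G = profile (card K - 1) K S (nbhd G)"
proof -
  have "h G = (\<Sum>v\<in>K. nxlogx (degree G v)) + (\<Sum>v\<in>S. nxlogx (degree G v))"
    unfolding h_def part(1)[symmetric] using finite_parts part by (intro sum.union_disjoint)
  then show ?thesis by (simp add: profile_def degree_clique) (simp add: degree_def)
qed

lemma uedges_eq:
  "uedges G = {e. e \<subseteq> K \<and> card e = 2} \<union> (\<Union>j\<in>S. (\<lambda>i. {i, j}) ` nbhd G j)" (is "_ = ?R")
proof
  show "uedges G \<subseteq> ?R"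
  proof
    fix e assume e: "e \<in> uedges G"
    then have "e \<subseteq> K \<union> S" "card e = 2" using simple part by (auto simp: simple_graph_def)
    then obtain u v where uv: "e = {u, v}" "u \<noteq> v" "u \<in> K \<union> S" "v \<in> K \<union> S"
      by (auto simp: card_2_iff)
    then have "\<not> (u \<in> S \<and> v \<in> S)" using stable e by (auto simp: is_stable_def)
    moreover have "e \<in> ?R" if "u \<in> K" "v \<in> K" using that uv by simp
    moreover have "e \<in> ?R" if "u \<in> K" "v \<in> S" using that uv e in_nbhd[of u v] by blast
    moreover have "e \<in> ?R" if "v \<in> K" "u \<in> S"
      using that uv e in_nbhd[of v u] by (auto simp: insert_commute)
    ultimately show "e \<in> ?R" using uv by blast
  qed
  show "?R \<subseteq> uedges G"
    using clique by (auto simp: is_clique_def nbhd_def card_2_iff)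
qed

lemma card_uedges: "card (uedges G) = (card K choose 2) + (\<Sum>j\<in>S. card (nbhd G j))"
proof -
  have fn: "finite (nbhd G j)" if "j \<in> S" for j
    using nbhd_stable that finite_parts finite_subset by blast
  have sep: "i \<in> K" "i \<noteq> j" "i \<notin> S" if "j \<in> S" "i \<in> nbhd G j" for i j
    using that nbhd_stable part by blast+
  have "card (uedges G) = card {e. e \<subseteq> K \<and> card e = 2} + card (\<Union>j\<in>S. (\<lambda>i. {i, j}) ` nbhd G j)"
    unfolding uedges_eq using finite_parts fn part
    by (intro card_Un_disjoint) auto
  also have "card {e. e \<subseteq> K \<and> card e = 2} = (card K choose 2)"
    using finite_parts by (simp add: n_subsets)
  also have "card (\<Union>j\<in>S. (\<lambda>i. {i, j}) ` nbhd G j) = (\<Sum>j\<in>S. card ((\<lambda>i. {i, j}) ` nbhd G j))"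
    using finite_parts fn sep by (intro card_UN_disjoint) (auto simp: doubleton_eq_iff)
  also have "\<dots> = (\<Sum>j\<in>S. card (nbhd G j))"
    using sep by (intro sum.cong refl card_image) (auto simp: inj_on_def doubleton_eq_iff)
  finally show ?thesis .
qed

section \<open>Cliques and the clique number of a split graph\<close>

lemma finite_cliques: "finite {Q. is_clique G Q}"
  using simple by (auto simp: is_clique_def simple_graph_def)

lemma clique_meets_stable:
  assumes "is_clique G Q" "i \<in> Q \<inter> S" "j \<in> Q \<inter> S"
  shows "i = j"
  using assms stable unfolding is_clique_def is_stable_def by blast

text \<open>A clique has at most one stable vertex. To reach size \<open>Suc (card K)\<close> it
  must consist of that vertex and all of \<open>K\<close>, which makes the vertex a full
  row.\<close>

lemma clique_card_le:
  assumes "is_clique G Q"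
  shows "card Q \<le> Suc (card K)"
    and "card Q = Suc (card K) \<Longrightarrow> \<exists>j\<in>S. nbhd G j = K"
proof -
  have Q: "Q \<subseteq> K \<union> S" using assms part by (simp add: is_clique_def)
  have "card Q \<le> Suc (card K) \<and> (card Q = Suc (card K) \<longrightarrow> (\<exists>j\<in>S. nbhd G j = K))"
  proof (cases "Q \<inter> S = {}")
    case True
    then have "Q \<subseteq> K" using Q by blast
    then have "card Q \<le> card K" using finite_parts by (simp add: card_mono)
    then show ?thesis by simp
  next
    case False
    then obtain j where j: "j \<in> Q" "j \<in> S" by blast
    then have QK: "Q - {j} \<subseteq> K" using Q clique_meets_stable[OF assms, of _ j] by blast
    have fQ: "finite Q" using Q finite_parts finite_subset by blast
    have c: "card Q = Suc (card (Q - {j}))" using fQ j by (metis card_Suc_Diff1)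
    have "nbhd G j = K" if "card Q = Suc (card K)"
    proof -
      have "Q - {j} = K" using QK c that finite_parts by (intro card_subset_eq) auto
      then have "K \<subseteq> nbhd G j" using assms j part unfolding is_clique_def nbhd_def by auto
      then show ?thesis using nbhd_stable[OF j(2)] by blast
    qed
    moreover have "card (Q - {j}) \<le> card K" using QK finite_parts by (simp add: card_mono)
    then have "card Q \<le> Suc (card K)" by (simp only: c)
    ultimately show ?thesis using j(2) by blast
  qed
  then show "card Q \<le> Suc (card K)" "card Q = Suc (card K) \<Longrightarrow> \<exists>j\<in>S. nbhd G j = K" by auto
qed

lemma clique_insert_full:
  assumes "j \<in> S" "nbhd G j = K"
  shows "is_clique G (insert j K)" "card (insert j K) = Suc (card K)"
proof -
  have j: "{i, j} \<in> uedges G" "{j, i} \<in> uedges G" if "i \<in> K" for i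
    using in_nbhd[OF that, of j] assms(2) that by (simp_all add: insert_commute)
  have "insert j K \<subseteq> uverts G" using assms(1) part by blast
  then show "is_clique G (insert j K)" using clique j unfolding is_clique_def by blast
  have "j \<notin> K" using assms(1) part by blast
  then show "card (insert j K) = Suc (card K)" using finite_parts by simp
qed

lemma clique_number_full:
  assumes "j \<in> S" "nbhd G j = K"
  shows "clique_number G = Suc (card K)"
  unfolding clique_number_def
proof (rule Max_eqI)
  show "Suc (card K) \<in> card ` {Q. is_clique G Q}"
    using clique_insert_full[OF assms] by (metis imageI mem_Collect_eq)
qed (use finite_cliques clique_card_le in auto)

lemma clique_number_attained: "\<exists>Q. is_clique G Q \<and> card Q = clique_number G"
proof -
  have "clique_number G \<in> card ` {Q. is_clique G Q}"
    unfolding clique_number_def using finite_cliques clique by (intro Max_in) auto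
  then show ?thesis by auto
qed

lemma clique_le_clique_number: "is_clique G Q \<Longrightarrow> card Q \<le> clique_number G"
  unfolding clique_number_def using finite_cliques by (intro Max_ge) auto

end

text \<open>
  If the clique of the given partition is maximum, some vertex of it has no stable neighbour; moving
  that vertex to the stable set makes it the full row.
\<close>
lemma threshold_split_with_full:
  assumes "threshold_graph G" "clique_number G = k" "k \<ge> 1"
  obtains K S j where "split_graph G K S"
    and "\<And>u v. u \<in> S \<Longrightarrow> v \<in> S \<Longrightarrow> nbhd G u \<subseteq> nbhd G v \<or> nbhd G v \<subseteq> nbhd G u"
    and "card K = k - 1" "j \<in> S" "nbhd G j = K"
proof -
  obtain K S where KS: "split_graph G K S"
    and chain: "\<And>u v. u \<in> S \<Longrightarrow> v \<in> S \<Longrightarrow> nbhd G u \<subseteq> nbhd G v \<or> nbhd G v \<subseteq> nbhd G u"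
    using assms(1) unfolding threshold_graph_def split_graph_def by blast
  interpret split_graph G K S by (rule KS)
  show thesis
  proof (cases "\<exists>j\<in>S. nbhd G j = K")
    case True
    then obtain j where j: "j \<in> S" "nbhd G j = K" by blast
    then show thesis using clique_number_full[OF j] assms(2) that[OF KS chain] by simp
  next
    case False
    obtain Q where Q: "is_clique G Q" "card Q = k" using clique_number_attained assms by blast
    \<comment> \<open>Without a full row no clique exceeds \<open>card K\<close>, so
      \<open>K\<close> is a maximum clique.\<close>
    have cK: "card K = k"
      using clique_card_le[OF Q(1)] False Q(2) clique_le_clique_number[OF clique] assms(2) by linarith
    then have "K \<noteq> {}" using assms(3) by auto
    then have "\<exists>v\<in>K. \<forall>j\<in>S. v \<notin> nbhd G j"
      using finite_parts chain nbhd_stable False by (intro chain_misses_point) blast+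
    then obtain v where v: "v \<in> K" "\<And>j. j \<in> S \<Longrightarrow> v \<notin> nbhd G j" by blast
    have iso: "{u, v} \<notin> uedges G" "{v, u} \<notin> uedges G" if "u \<in> S" for u
      using in_nbhd[OF v(1), of u] v(2)[OF that] by (simp_all add: insert_commute)
    have nv: "nbhd G v = K - {v}"
    proof
      show "nbhd G v \<subseteq> K - {v}"
        using part no_loop iso unfolding nbhd_def by blast
      show "K - {v} \<subseteq> nbhd G v"
        using part clique v(1) unfolding is_clique_def nbhd_def by blast
    qed
    have "{u, w} \<notin> uedges G" if "u \<in> insert v S" "w \<in> insert v S" for u w
      using that stable iso no_loop unfolding is_stable_def by blast
    then have "is_stable G (insert v S)"
      using part v(1) unfolding is_stable_def by blast
    moreover have "is_clique G (K - {v})" using clique unfolding is_clique_def by blast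
    moreover have "(K - {v}) \<union> insert v S = uverts G" "(K - {v}) \<inter> insert v S = {}"
      using part v(1) by blast+
    ultimately have split: "split_graph G (K - {v}) (insert v S)"
      using simple by unfold_locales
    \<comment> \<open>The old stable neighbourhoods lie in \<open>K\<close> and avoid
      \<open>v\<close>, hence lie in \<open>nbhd G v\<close>, which becomes the top of the
      chain.\<close>
    have nested: "nbhd G u \<subseteq> nbhd G w \<or> nbhd G w \<subseteq> nbhd G u"
      if "u \<in> insert v S" "w \<in> insert v S" for u w
    proof -
      have "nbhd G j \<subseteq> nbhd G v" if "j \<in> S" for j
        using nbhd_stable[OF that] v(2)[OF that] nv by blast
      then show ?thesis using that chain by blast
    qed
    have "card (K - {v}) = k - 1" using v cK by simp
    then show thesis using nv by (intro that[OF split nested]) auto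
  qed
qed

subsection \<open>The extremal graph\<close>

text \<open>Two of the three edge families merge: a clique vertex is adjacent to every other vertex
  below \<open>k - 1 + a\<close>. The later checks on this graph thus reduce to
  inequalities.\<close>

lemma C_graph_ab_edge_iff:
  assumes "b \<le> k - 1"
  shows "{u, v} \<in> uedges (C_graph_ab k a b) \<longleftrightarrow>
    u \<noteq> v \<and> (u < k - 1 \<and> v < k - 1 + a \<or> v < k - 1 \<and> u < k - 1 + a
      \<or> u < b \<and> v = k - 1 + a \<or> v < b \<and> u = k - 1 + a)"
proof -
  have "{u, v} \<in> uedges (C_graph_ab k a b) \<longleftrightarrow>
    (\<exists>x y. {u, v} = {x, y} \<and> x < k - 1 \<and> y < k - 1 \<and> x \<noteq> y) \<or>
    (\<exists>x y. {u, v} = {x, y} \<and> x < k - 1 \<and> k - 1 \<le> y \<and> y < k - 1 + a) \<or>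
    (\<exists>x. {u, v} = {x, k - 1 + a} \<and> x < b)"
    by (simp add: C_graph_ab_def)
  also have "(\<exists>x y. {u, v} = {x, y} \<and> x < k - 1 \<and> y < k - 1 \<and> x \<noteq> y) \<longleftrightarrow> u < k - 1 \<and> v < k - 1 \<and> u \<noteq> v"
    unfolding doubleton_eq_iff by blast
  also have "(\<exists>x y. {u, v} = {x, y} \<and> x < k - 1 \<and> k - 1 \<le> y \<and> y < k - 1 + a) \<longleftrightarrow>
      u < k - 1 \<and> k - 1 \<le> v \<and> v < k - 1 + a \<or> v < k - 1 \<and> k - 1 \<le> u \<and> u < k - 1 + a"
    unfolding doubleton_eq_iff by blast
  also have "(\<exists>x. {u, v} = {x, k - 1 + a} \<and> x < b) \<longleftrightarrow> u < b \<and> v = k - 1 + a \<or> v < b \<and> u = k - 1 + a"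
    unfolding doubleton_eq_iff by blast
  finally show ?thesis using assms by linarith
qed

lemma uverts_C_graph_ab: "uverts (C_graph_ab k a b) = {..k - 1 + a}"
  by (auto simp: C_graph_ab_def)

lemma split_graph_C_graph_ab:
  assumes "b \<le> k - 1"
  shows "split_graph (C_graph_ab k a b) {..<k - 1} {k - 1..k - 1 + a}"
proof
  have "e \<subseteq> {..k - 1 + a} \<and> card e = 2" if e: "e \<in> uedges (C_graph_ab k a b)" for e
  proof -
    obtain u v where uv: "e = {u, v}" using e unfolding C_graph_ab_def snd_conv by blast
    have "u \<noteq> v" "u \<le> k - 1 + a" "v \<le> k - 1 + a"
      using e assms unfolding uv C_graph_ab_edge_iff[OF assms] by linarith+
    then show ?thesis by (simp add: uv)
  qed
  then show "simple_graph (C_graph_ab k a b)"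
    by (simp add: simple_graph_def uverts_C_graph_ab)
  show "is_clique (C_graph_ab k a b) {..<k - 1}"
    unfolding is_clique_def uverts_C_graph_ab C_graph_ab_edge_iff[OF assms] by auto
  show "is_stable (C_graph_ab k a b) {k - 1..k - 1 + a}"
    unfolding is_stable_def uverts_C_graph_ab C_graph_ab_edge_iff[OF assms] using assms by auto
qed (auto simp: uverts_C_graph_ab)

lemma nbhd_C_graph_ab:
  assumes "b \<le> k - 1"
  shows "j \<in> {k - 1..<k - 1 + a} \<Longrightarrow> nbhd (C_graph_ab k a b) j = {..<k - 1}"
    and "nbhd (C_graph_ab k a b) (k - 1 + a) = {..<b}"
  unfolding nbhd_def uverts_C_graph_ab C_graph_ab_edge_iff[OF assms] using assms by auto

theorem theorem12:
  fixes k m a b :: nat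
  assumes "k \<ge> 2"
    and "a > 0"
    and "b \<le> k - 2"
    and "m = (k - 1 choose 2) + a * (k - 1) + b"
  shows "threshold_graph (C_graph m k) \<and> clique_number (C_graph m k) = k \<and>
         card (uedges (C_graph m k)) = m \<and>
         (\<forall>G :: 'a ugraph.
            threshold_graph G \<and> clique_number G = k \<and> card (uedges G) = m
              \<longrightarrow> h G \<le> h (C_graph m k))"
proof -
  define n where "n = k - 1"
  define C where "C = C_graph_ab k a b"
  have n: "n > 0" and k: "k = Suc n" and bn: "b < n" and bk: "b \<le> k - 1"
    using assms by (auto simp: n_def)
  have C: "C_graph m k = C" unfolding C_def using assms by (intro C_graph_eq) auto
  interpret C: split_graph C "{..<n}" "{n..n + a}"
    unfolding C_def n_def using bk by (rule split_graph_C_graph_ab)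
  have full: "nbhd C j = {..<n}" if "j \<in> {n..<n + a}" for j
    unfolding C_def n_def using nbhd_C_graph_ab(1)[OF bk] that by (simp add: n_def)
  have last: "nbhd C (n + a) = {..<b}"
    unfolding C_def n_def by (rule nbhd_C_graph_ab(2)[OF bk])
  have S: "{n..n + a} = insert (n + a) {n..<n + a}" by auto
  have nb: "nbhd C j = (if j = n + a then {..<b} else {..<n})" if "j \<in> {n..n + a}" for j
    using that full last by auto
  have "nbhd C u \<subseteq> nbhd C v \<or> nbhd C v \<subseteq> nbhd C u" if "u \<in> {n..n + a}" "v \<in> {n..n + a}" for u v
    unfolding nb[OF that(1)] nb[OF that(2)] using bn by auto
  then have threshold: "threshold_graph C"
    unfolding threshold_graph_def using C.simple C.part C.clique C.stable by blast
  have number: "clique_number C = k"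
    using C.clique_number_full[of n] full assms(2) k by simp
  have edges: "card (uedges C) = m"
  proof -
    have "(\<Sum>j\<in>{n..n + a}. card (nbhd C j)) = a * n + b"
      unfolding S using full last by simp
    then show ?thesis using C.card_uedges assms(4) by (simp add: n_def)
  qed
  \<comment> \<open>As \<open>a > 0\<close>, vertex \<open>n\<close> is a full row. Stripping it
    leaves \<open>a - 1\<close> full rows and raises the base value from \<open>n - 1\<close> to
    \<open>n\<close>.\<close>
  have hC: "h C = nxlogx n + packed n n (a - 1) b"
  proof -
    have "profile n {..<n} ({n..n + a} - {n}) (nbhd C) = packed n n (a - 1) b"
    proof -
      have S': "{n..n + a} - {n} = insert (n + a) {Suc n..<n + a}" using assms(2) by auto
      have "card {j \<in> {n..n + a} - {n}. i \<in> nbhd C j} = a - 1 + (if i < b then 1 else 0)" if "i < n" for i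
      proof -
        have "{j \<in> {n..n + a} - {n}. i \<in> nbhd C j} = {Suc n..<n + a} \<union> (if i < b then {n + a} else {})"
          unfolding S' using that full last by auto
        then show ?thesis by simp
      qed
      then have "(\<Sum>i<n. nxlogx (n + card {j \<in> {n..n + a} - {n}. i \<in> nbhd C j}))
          = (\<Sum>i<n. if i < b then nxlogx (n + (a - 1) + 1) else nxlogx (n + (a - 1)))"
        by (intro sum.cong) (auto simp: add_ac)
      also have "\<dots> = real b * nxlogx (n + (a - 1) + 1) + (real n - real b) * nxlogx (n + (a - 1))"
      proof -
        have "{..<n} \<inter> {i. i < b} = {..<b}" "{..<n} \<inter> - {i. i < b} = {b..<n}" using bn by auto
        then show ?thesis using bn by (simp add: sum.If_cases)
      qed
      moreover have "(\<Sum>j\<in>{n..n + a} - {n}. nxlogx (card (nbhd C j))) = real (a - 1) * nxlogx n + nxlogx b"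
        unfolding S' using full last by (simp add: add.commute)
      ultimately show ?thesis by (simp only: profile_def packed_def add.assoc)
    qed
    then show ?thesis
      using profile_remove_full[of "{n..n + a}" n "nbhd C" "{..<n}" "n - 1"] full assms(2) n
      by (simp add: C.h_eq_profile)
  qed
  have "h G \<le> h C"
    if G: "threshold_graph G" "clique_number G = k" "card (uedges G) = m" for G :: "'a ugraph"
  proof -
    obtain K S j where KS: "split_graph G K S"
      and chain: "\<And>u v. u \<in> S \<Longrightarrow> v \<in> S \<Longrightarrow> nbhd G u \<subseteq> nbhd G v \<or> nbhd G v \<subseteq> nbhd G u"
      and K: "card K = k - 1" and j: "j \<in> S" "nbhd G j = K"
      using threshold_split_with_full[OF G(1,2)] assms(1) by auto
    interpret split_graph G K S by (rule KS)
    have cK: "card K = n" using K by (simp add: n_def)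
    have "a * n + b = (\<Sum>j\<in>S. card (nbhd G j))"
      using card_uedges G(3) assms(4) cK by (simp add: n_def)
    also have "\<dots> = n + (\<Sum>j\<in>S - {j}. card (nbhd G j))"
      using j finite_parts cK by (simp add: sum.remove)
    \<comment> \<open>The full row \<open>j\<close> accounts for \<open>n\<close> cells, so the
      remaining diagram has the same number of cells as that of \<open>C\<close> without vertex
      \<open>n\<close>.\<close>
    finally have "(a - 1) * card K + b = (\<Sum>j\<in>S - {j}. card (nbhd G j))"
      using assms(2) cK by (cases a) auto
    then have "profile n K (S - {j}) (nbhd G) \<le> packed n (card K) (a - 1) b"
      using finite_parts cK bn nbhd_stable chain by (intro profile_le_packed) auto
    then show ?thesis
      using profile_remove_full[of S j "nbhd G" K "n - 1"] finite_parts j n cK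
      by (simp add: h_eq_profile hC)
  qed
  then show ?thesis unfolding C using threshold number edges by blast
qed

end
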